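(* For every integer $s\ge 2$ there exists a constant $C=C(s)>0$, depending only on $s$, such that the following holds. Let $\Delta>0$, $\rho\ge 0$, $\ell$ an integer with $2\le \ell\le s$, and $\tau$ with $\ell-1\le\tau<\pi/\Delta$ be such that $4\tau\Delta\le\rho$. Let $\boldsymbol{x}=(t_1,\dots,t_s)$ be any node vector forming a $(\Delta,\rho,s,\ell,\tau)$-clustered configuration, and let $\Omega$ be any number satisfying $$\frac{4\pi s}{\rho}\le \Omega\le \frac{\pi s}{\tau\Delta}.$$ Then $$\sigma_{\min}\left(\mathbf{V}_N(\boldsymbol{x},\Omega)\right)\ge C\cdot(\Delta\Omega)^{\ell-1}\qquad\text{for every } N\in\mathbb{N} \text{ with } N>2s^3\left\lceil \frac{\Omega}{4s}\right\rceil,$$ and $$\lambda_{\min}\left(\mathbf{G}(\boldsymbol{x},\Omega)\right)\ge C^2\cdot(\Delta\Omega)^{2(\ell-1)}.$$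
   Context: Wrap-around distance: for $t\in\mathbb{R}$, $\|t\|_{\mathbb{T}}:=|\operatorname{Arg}\exp(\imath t)|=|t \bmod (-\pi,\pi]|$, where $\operatorname{Arg}$ takes values in $(-\pi,\pi]$. Clustered configuration: let $\Delta>0$, $2\le\ell\le s$, $\ell-1\le\tau<\pi/\Delta$, $\rho\ge 0$. A vector $\boldsymbol{x}=(t_1,\dots,t_s)$ of $s$ distinct nodes in $(-\frac{\pi}{2},\frac{\pi}{2}]$ forms a $(\Delta,\rho,s,\ell,\tau)$-clustered configuration if for each $t_j$ there exist at most $\ell$ distinct nodes $\boldsymbol{x}^{(j)}=\{t_{j,k}\}_{k=1,\dots,r_j}\subset\boldsymbol{x}$, $1\le r_j\le \ell$, $t_{j,1}\equiv t_j$, such that: (1) for any $y\in\boldsymbol{x}^{(j)}\setminus\{t_j\}$, $\Delta\le\|y-t_j\|_{\mathbb{T}}\le\tau\Delta$; (2) for any $y\in\boldsymbol{x}\setminus\boldsymbol{x}^{(j)}$, $\|y-t_j\|_{\mathbb{T}}\ge\rho$. Matrices: for $N\in\mathbb{N}$ and $\Omega>0$, $\mathbf{V}_N(\boldsymbol{x},\Omega)$ is the $(2N+1)\times s$ matrix $$\mathbf{V}_N(\boldsymbol{x},\Omega)=\frac{1}{\sqrt{2N}}\left[\exp\left(\imath k\frac{t_j\Omega}{N}\right)\right]_{k=-N,\dots,N}^{j=1,\dots,s}$$ (row index $k$, column index $j$), and $\mathbf{G}(\boldsymbol{x},\Omega)$ is the $s\times s$ matrix $[\operatorname{sinc}(\Omega(t_i-t_j))]_{1\le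 i,j\le s}$, where $\operatorname{sinc}(t)=\frac{\sin t}{t}$ for $t\ne0$ and $\operatorname{sinc}(0)=1$. $\lambda_{\min}$ is the minimal eigenvalue, and $\sigma_{\min}(\mathbf{V}):=\sqrt{\lambda_{\min}(\mathbf{V}^H\mathbf{V})}$. *)

theory Defs
  imports
    "HOL-Probability.Sinc_Integral"
    "Jordan_Normal_Form.Schur_Decomposition"
begin

definition wrap_norm :: "real \<Rightarrow> real" where
  "wrap_norm t = \<bar>Arg (exp (\<i> * complex_of_real t))\<bar>"

(* A node vector (t_1, ..., t_s) is the list x with t_j = x ! (j - 1).  As the nodes are distinct,
   the subset X plays the role of the subvector x^(j) = {t_{j,1}, ..., t_{j,r_j}} attached to
   t = t_j.  The standing constraints on the parameters are not part of the predicate. *)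
definition clustered_configuration ::
    "real \<Rightarrow> real \<Rightarrow> nat \<Rightarrow> nat \<Rightarrow> real \<Rightarrow> real list \<Rightarrow> bool" where
  "clustered_configuration \<Delta> \<rho> s l \<tau> x \<longleftrightarrow>
     length x = s \<and> distinct x \<and> set x \<subseteq> {- (pi / 2) <.. pi / 2} \<and>
     (\<forall>t \<in> set x. \<exists>X \<subseteq> set x. t \<in> X \<and> card X \<le> l \<and>
        (\<forall>y \<in> X - {t}. \<Delta> \<le> wrap_norm (y - t) \<and> wrap_norm (y - t) \<le> \<tau> * \<Delta>) \<and>
        (\<forall>y \<in> set x - X. \<rho> \<le> wrap_norm (y - t)))"

(* Row r (counted from 0) carries the frequency k = r - N. *)
definition V_mat :: "nat \<Rightarrow> real list \<Rightarrow> real \<Rightarrow> complex mat" where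
  "V_mat N x \<Omega> = mat (2 * N + 1) (length x)
     (\<lambda>(r, j). complex_of_real (1 / sqrt (2 * real N)) *
        exp (\<i> * of_int (int r - int N) * complex_of_real (x ! j * \<Omega> / real N)))"

(* The entries are real; they are embedded into the complex numbers so that lambda_min applies. *)
definition G_mat :: "real list \<Rightarrow> real \<Rightarrow> complex mat" where
  "G_mat x \<Omega> = mat (length x) (length x)
     (\<lambda>(i, j). complex_of_real (sinc (\<Omega> * (x ! i - x ! j))))"

(* Intended for Hermitian matrices of positive size, whose eigenvalues are finitely many reals. *)
definition lambda_min :: "complex mat \<Rightarrow> real" where
  "lambda_min A = Min {r. eigenvalue A (complex_of_real r)}"

definition sigma_min :: "complex mat \<Rightarrow> real" where
  "sigma_min V = sqrt (lambda_min (mat_adjoint V * V))"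

end

theory Submission
  imports Defs "Jordan_Normal_Form.Spectral_Radius" "HOL-Real_Asymp.Real_Asymp"
begin

text \<open>
  Both bounds say that a Hermitian matrix has a quadratic form of at least
  \<open>C\<^sup>2 * (\<Delta> * \<Omega>) ^ (2 * (l - 1))\<close> times the squared norm of the coefficient vector
  (lemma \<open>lambda_min_ge\<close>). For the Gram matrix of \<open>V_mat N x \<Omega>\<close> the form is, up to the
  factor \<open>1 / (2 * N)\<close>, the energy of the exponential sum \<open>f k = (\<Sum>m. c m * w m ^ k)\<close> over
  \<open>2 * N + 1\<close> consecutive \<open>k\<close>, where \<open>w m = cis (x ! m * \<Omega> / N)\<close> and \<open>\<bar>c m\<bar>\<close> is the modulus of
  the given coefficient.

  To bound one coefficient \<open>c j\<close> by this energy, the other exponentials are removed one at a time.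
  The operator that sends \<open>f\<close> to \<open>f (k + q) - w m ^ q * f k\<close> annihilates node \<open>m\<close> and multiplies
  \<open>c j\<close> by \<open>w j ^ q - w m ^ q\<close>. It at most quadruples the energy and shortens the window by \<open>q\<close>. As
  long as the shifts add up to at most \<open>N\<close>, a window of length \<open>N\<close> remains on which only
  \<open>c j * w j ^ k\<close>, times the product of the chords, is left; its energy is explicit
  (\<open>exponential_sum_coefficient_bound\<close>).

  It remains to find, for every \<open>m\<close>, a shift of size at most \<open>N / s\<close> with a long chord.
  A node of the same cluster differs from node \<open>j\<close> by at least \<open>\<Delta> * \<Omega>\<close> and at most \<open>pi * s\<close> after
  scaling by \<open>\<Omega>\<close>, so a shift of about \<open>N / (2 * s)\<close> does not wrap around and gives a chord of order
  \<open>\<Delta> * \<Omega> / s\<close> (\<open>near_shift\<close>). A node of another cluster differs by at least \<open>4 * pi * s\<close>, so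
  a shift of size at most \<open>N / s\<close> already turns it to an angle bounded away from \<open>0\<close> and \<open>2 * pi\<close>,
  and the chord is at least \<open>1\<close> (\<open>far_shift\<close>). At most \<open>l - 1\<close> nodes are of
  the first kind, which gives the exponent \<open>l - 1\<close>; all other factors depend on \<open>s\<close> only.

  Since the bound is uniform in \<open>N\<close>, it passes to the limit: the entries of the Gram matrices are
  normalised Dirichlet kernels, which converge to the sinc entries of \<open>G_mat x \<Omega>\<close>
  (\<open>quad_form_V_gram_tendsto_G\<close>).
\<close>

section \<open>Cancelling all nodes but one by shifts\<close>

lemma sum_shifted_difference_le:
  fixes f :: "nat \<Rightarrow> complex"
  assumes "norm z = 1"
  shows "(\<Sum>k<n. (norm (f (k + q) - z * f k))\<^sup>2) \<le> 4 * (\<Sum>k<n + q. (norm (f k))\<^sup>2)"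
proof -
  have pt: "(norm (f (k + q) - z * f k))\<^sup>2 \<le> 2 * (norm (f (k + q)))\<^sup>2 + 2 * (norm (f k))\<^sup>2" for k
  proof -
    have "norm (f (k + q) - z * f k) \<le> norm (f (k + q)) + norm (f k)"
      using norm_triangle_ineq4[of "f (k + q)" "z * f k"] assms by (simp add: norm_mult)
    then have "(norm (f (k + q) - z * f k))\<^sup>2 \<le> (norm (f (k + q)) + norm (f k))\<^sup>2"
      by (intro power_mono) auto
    also have "\<dots> \<le> 2 * (norm (f (k + q)))\<^sup>2 + 2 * (norm (f k))\<^sup>2"
      using sum_squares_bound[of "norm (f (k + q))" "norm (f k)"]
      by (simp add: power2_sum)
    finally show ?thesis .
  qed
  have "(\<Sum>k<n. (norm (f (k + q) - z * f k))\<^sup>2)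
      \<le> 2 * (\<Sum>k<n. (norm (f (k + q)))\<^sup>2) + 2 * (\<Sum>k<n. (norm (f k))\<^sup>2)"
    using sum_mono[of "{..<n}", OF pt] by (simp add: sum.distrib sum_distrib_left)
  moreover have "(\<Sum>k<n. (norm (f (k + q)))\<^sup>2) \<le> (\<Sum>k<n + q. (norm (f k))\<^sup>2)"
  proof -
    have "(\<Sum>k<n. (norm (f (k + q)))\<^sup>2) = (\<Sum>k\<in>{q..<n + q}. (norm (f k))\<^sup>2)"
      using sum.shift_bounds_nat_ivl[of "\<lambda>k. (norm (f k))\<^sup>2" 0 q n]
      by (simp add: atLeast0LessThan)
    also have "\<dots> \<le> (\<Sum>k<n + q. (norm (f k))\<^sup>2)"
      by (rule sum_mono2) auto
    finally show ?thesis .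
  qed
  moreover have "(\<Sum>k<n. (norm (f k))\<^sup>2) \<le> (\<Sum>k<n + q. (norm (f k))\<^sup>2)"
    by (rule sum_mono2) auto
  ultimately show ?thesis
    by linarith
qed

text \<open>
  Induction on the set of nodes to be removed: one shifted difference turns the sum over
  \<open>insert j (insert m S)\<close> into a sum over \<open>insert j S\<close> with new coefficients, which is why the
  induction hypothesis is needed for all \<open>c\<close>. The chords are halved because each difference costs a
  factor \<open>4\<close> in energy.
\<close>

lemma exponential_sum_coefficient_bound:
  fixes w :: "'a \<Rightarrow> complex"
  assumes "finite S" "j \<notin> S" "\<And>m. m \<in> S \<Longrightarrow> norm (w m) = 1" "norm (w j) = 1"
  shows "(norm (c j))\<^sup>2 * n * (\<Prod>m\<in>S. (norm (w j ^ q m - w m ^ q m) / 2)\<^sup>2)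
    \<le> (\<Sum>k<n + sum q S. (norm (\<Sum>m\<in>insert j S. c m * w m ^ k))\<^sup>2)"
  using assms
proof (induction S arbitrary: c rule: finite_induct)
  case empty
  then show ?case by (simp add: norm_mult norm_power)
next
  case (insert m S)
  define z where "z = w m ^ q m"
  define f where "f k = (\<Sum>i\<in>insert j (insert m S). c i * w i ^ k)" for k :: nat
  have z: "norm z = 1"
    using insert.prems by (simp add: z_def norm_power)
  have f: "f (k + q m) - z * f k = (\<Sum>i\<in>insert j S. c i * (w i ^ q m - z) * w i ^ k)" for k
  proof -
    have "f (k + q m) - z * f k = (\<Sum>i\<in>insert j (insert m S). c i * (w i ^ q m - z) * w i ^ k)"
      by (simp only: f_def sum_distrib_left sum_subtractf[symmetric])
        (rule sum.cong, simp_all add: algebra_simps power_add)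
    also have "\<dots> = (\<Sum>i\<in>insert j S. c i * (w i ^ q m - z) * w i ^ k)"
      by (rule sum.mono_neutral_right) (use insert.hyps in \<open>auto simp: z_def\<close>)
    finally show ?thesis .
  qed
  let ?P = "\<Prod>i\<in>S. (norm (w j ^ q i - w i ^ q i) / 2)\<^sup>2"
  have "(norm (c j * (w j ^ q m - z)))\<^sup>2 * n * ?P
     \<le> (\<Sum>k<n + sum q S. (norm (\<Sum>i\<in>insert j S. c i * (w i ^ q m - z) * w i ^ k))\<^sup>2)"
    by (rule insert.IH) (use insert.prems in auto)
  also have "\<dots> \<le> 4 * (\<Sum>k<n + sum q S + q m. (norm (f k))\<^sup>2)"
    unfolding f[symmetric] by (rule sum_shifted_difference_le[OF z])
  also have "n + sum q S + q m = n + sum q (insert m S)"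
    using insert.hyps by simp
  finally have "(norm (c j * (w j ^ q m - z)))\<^sup>2 / 4 * n * ?P
      \<le> (\<Sum>k<n + sum q (insert m S). (norm (f k))\<^sup>2)"
    by simp
  moreover have "(norm (c j * (w j ^ q m - z)))\<^sup>2 / 4
      = (norm (c j))\<^sup>2 * (norm (w j ^ q m - w m ^ q m) / 2)\<^sup>2"
    by (simp add: z_def norm_mult power_mult_distrib power_divide)
  ultimately show ?case
    using insert.hyps by (simp add: f_def mult_ac)
qed

section \<open>Choice of the shifts\<close>

lemma half_le_sin:
  fixes y :: real
  assumes "0 \<le> y" "y \<le> pi / 3"
  shows "y / 2 \<le> sin y"
proof -
  have "sin 0 - 0 / 2 \<le> sin y - y / 2"
  proof (rule DERIV_nonneg_imp_nondecreasing[of 0 y "\<lambda>x. sin x - x / 2"])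
    fix x :: real assume x: "0 \<le> x" "x \<le> y"
    have "cos (pi / 3) \<le> cos x"
      by (rule cos_monotone_0_pi_le) (use x assms in auto)
    then have "0 \<le> cos x - 1 / 2"
      by (simp add: cos_60)
    moreover have "((\<lambda>x. sin x - x / 2) has_real_derivative cos x - 1 / 2) (at x)"
      by (auto intro!: derivative_eq_intros)
    ultimately show "\<exists>d. ((\<lambda>x. sin x - x / 2) has_real_derivative d) (at x) \<and> 0 \<le> d"
      by blast
  qed (use assms in auto)
  then show ?thesis by simp
qed

lemma norm_cis_diff: "norm (cis a - cis b) = 2 * \<bar>sin ((a - b) / 2)\<bar>"
proof -
  have "cis a - cis b = cis b * (exp (\<i> * of_real (a - b)) - 1)"
    by (simp add: right_diff_distrib cis_mult del: of_real_diff flip: cis_conv_exp)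
  then show ?thesis
    by (simp add: norm_mult dist_exp_i_1 del: of_real_diff)
qed

text \<open>
  As long as the half-angle does not exceed \<open>pi\<close>, the sine is nonnegative and half of the
  chord equals it without an absolute value.
\<close>

lemma norm_cis_power_diff:
  "norm (cis (a / real N) ^ q - cis (b / real N) ^ q) / 2 = sin (real q * \<bar>a - b\<bar> / (2 * real N))"
  if "real q * \<bar>a - b\<bar> / (2 * real N) \<le> pi"
proof -
  define y where "y = real q * \<bar>a - b\<bar> / (2 * real N)"
  have "0 \<le> sin y"
    by (rule sin_ge_zero) (use that in \<open>auto simp: y_def\<close>)
  moreover have "(real q * (a / real N) - real q * (b / real N)) / 2 = y
      \<or> (real q * (a / real N) - real q * (b / real N)) / 2 = - y"
    by (cases "a \<ge> b") (auto simp: y_def algebra_simps abs_if diff_divide_distrib)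
  ultimately show ?thesis
    unfolding y_def[symmetric] by (auto simp: Complex.DeMoivre norm_cis_diff)
qed

text \<open>
  The shift \<open>N div (2 * s)\<close> lies between \<open>N / (4 * s)\<close> and \<open>N / (2 * s)\<close>. The upper estimate keeps
  the half-angle below \<open>pi / 4\<close>, where the sine is comparable to its argument; the lower
  estimate makes the half-angle at least \<open>\<delta> / (8 * s)\<close>.
\<close>

lemma near_shift:
  fixes a b \<delta> :: real and N s :: nat
  assumes "s > 0" "2 * s \<le> N" "0 \<le> \<delta>" "\<delta> \<le> \<bar>a - b\<bar>" "\<bar>a - b\<bar> \<le> pi * s"
  shows "\<exists>q. real q \<le> N / s \<and>
    \<delta> / (16 * real s) \<le> norm (cis (a / N) ^ q - cis (b / N) ^ q) / 2"
proof (intro exI conjI)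
  define q where "q = N div (2 * s)"
  define y where "y = real q * \<bar>a - b\<bar> / (2 * real N)"
  have N: "N > 0" using assms by simp
  have le: "real q \<le> N / (2 * s)"
    using of_nat_mono[OF div_times_less_eq_dividend[of N "2 * s"], where 'a = real] assms
    by (simp add: q_def field_simps)
  have ge: "N / (4 * s) \<le> real q"
  proof -
    have "1 \<le> q"
      using assms by (simp add: q_def Suc_le_eq div_greater_zero_iff)
    moreover have "N < 2 * s * (q + 1)"
      using assms dividend_less_div_times[of "2 * s" N] by (simp add: q_def algebra_simps)
    moreover have "2 * s * (q + 1) \<le> 2 * s * (q + q)"
      by (intro mult_left_mono) (use \<open>1 \<le> q\<close> in auto)
    ultimately have "N \<le> 2 * s * (q + q)" by linarith
    also have "2 * s * (q + q) = 4 * s * q" by simp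
    finally have "N \<le> 4 * s * q" .
    then have "real N \<le> 4 * s * q"
      by (metis of_nat_le_iff of_nat_mult of_nat_numeral)
    then show ?thesis using assms by (simp add: field_simps)
  qed
  show "real q \<le> N / s"
    using le by (rule order_trans) (use assms in \<open>auto simp: field_simps\<close>)
  have "y \<le> (N / (2 * s)) * (pi * s) / (2 * real N)"
    unfolding y_def by (intro divide_right_mono mult_mono le assms) auto
  also have "\<dots> = pi / 4"
    using assms N by simp
  finally have "y \<le> pi / 4" .
  moreover have "0 \<le> y" by (simp add: y_def)
  ultimately have y: "0 \<le> y" "y \<le> pi / 3" "y \<le> pi" using pi_gt_zero by linarith+
  have "(N / (4 * s)) * \<delta> / (2 * real N) \<le> y"
    unfolding y_def by (intro divide_right_mono mult_mono ge assms) (use assms in auto)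
  moreover have "(N / (4 * s)) * \<delta> / (2 * N) = \<delta> / (8 * s)"
    using N by (simp add: field_simps)
  ultimately have "\<delta> / (8 * s) \<le> y" by simp
  moreover have "y / 2 \<le> sin y"
    by (rule half_le_sin) (fact y)+
  ultimately have "\<delta> / (16 * real s) \<le> sin y" by simp
  then show "\<delta> / (16 * real s) \<le> norm (cis (a / N) ^ q - cis (b / N) ^ q) / 2"
    using norm_cis_power_diff[OF y(3)[unfolded y_def]] by (simp add: y_def)
qed

text \<open>
  The shift is the first integer for which the half-angle reaches \<open>pi / 6\<close>. One step moves the
  half-angle by at most \<open>pi / 4\<close>, because \<open>\<bar>a - b\<bar> \<le> pi * N / 2\<close>, so the half-angle is still below
  \<open>pi / 2\<close> and its sine is at least \<open>1 / 2\<close>. The large separation makes the shift small.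
\<close>

lemma far_shift:
  fixes a b :: real and N s :: nat
  assumes "s > 0" "2 * s \<le> N" "4 * pi * s \<le> \<bar>a - b\<bar>" "\<bar>a - b\<bar> \<le> pi * N / 2"
  shows "\<exists>q. real q \<le> N / s \<and> 1 / 2 \<le> norm (cis (a / N) ^ q - cis (b / N) ^ q) / 2"
proof (intro exI conjI)
  define D where "D = \<bar>a - b\<bar>"
  define q where "q = nat \<lceil>N * pi / (3 * D)\<rceil>"
  define y where "y = real q * D / (2 * real N)"
  have N: "N > 0" using assms by simp
  have "0 < 4 * pi * s" using assms by simp
  then have D: "D > 0" using assms unfolding D_def by linarith
  have "0 \<le> N * pi / (3 * D)" using D by simp
  then have q: "N * pi / (3 * D) \<le> q" "q \<le> N * pi / (3 * D) + 1"
    unfolding q_def by linarith+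
  have "N * pi / (3 * D) \<le> N * pi / (3 * (4 * pi * s))"
    by (rule divide_left_mono) (use assms D in \<open>auto simp: D_def\<close>)
  then have "real q \<le> N / (12 * s) + 1" using q by simp
  also have "1 \<le> N / (2 * s)"
    using assms by (simp add: field_simps flip: of_nat_mult)
  finally show "real q \<le> N / s"
    using assms by (simp add: field_simps)
  have "(N * pi / (3 * D)) * D / (2 * real N) \<le> y"
    unfolding y_def by (intro divide_right_mono mult_right_mono q) (use D in auto)
  then have y1: "pi / 6 \<le> y" using N D by simp
  have "y \<le> (N * pi / (3 * D) + 1) * D / (2 * real N)"
    unfolding y_def by (intro divide_right_mono mult_right_mono q) (use D in auto)
  also have "\<dots> = pi / 6 + D / (2 * N)"
    using N D by (simp add: field_simps)
  also have "D / (2 * N) \<le> pi / 4"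
    using assms N by (simp add: D_def field_simps)
  finally have y2: "y \<le> pi / 2" "y \<le> pi" using pi_gt_zero by linarith+
  have "sin (pi / 6) \<le> sin y"
    by (rule sin_monotone_2pi_le) (use y1 y2 in auto)
  then show "1 / 2 \<le> norm (cis (a / N) ^ q - cis (b / N) ^ q) / 2"
    using norm_cis_power_diff[OF y2(2)[unfolded y_def D_def]] by (simp add: y_def D_def sin_30)
qed

section \<open>Lower bound for sums over a clustered set of frequencies\<close>

text \<open>
  The set \<open>K\<close> holds the remaining nodes of the cluster of \<open>j\<close>. Its factors are at most \<open>1\<close>, as
  \<open>\<delta> \<le> pi * s\<close>, so replacing \<open>card K\<close> by the larger \<open>d\<close> only weakens the bound. Likewise the
  factors \<open>1 / 4\<close> of the other nodes are counted \<open>s\<close> times.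
\<close>

lemma clustered_sum_coefficient_bound:
  fixes \<theta> :: "nat \<Rightarrow> real" and c :: "nat \<Rightarrow> complex"
  assumes s: "s > 0" "2 * s \<le> N" and j: "j < s"
    and \<delta>: "0 < \<delta>" "\<delta> \<le> pi * s"
    and K: "K \<subseteq> {..<s} - {j}" "card K \<le> d"
    and near: "\<And>m. m \<in> K \<Longrightarrow> \<delta> \<le> \<bar>\<theta> j - \<theta> m\<bar> \<and> \<bar>\<theta> j - \<theta> m\<bar> \<le> pi * s"
    and far: "\<And>m. m \<in> {..<s} - {j} - K \<Longrightarrow>
      4 * pi * s \<le> \<bar>\<theta> j - \<theta> m\<bar> \<and> \<bar>\<theta> j - \<theta> m\<bar> \<le> pi * N / 2"
  shows "(norm (c j))\<^sup>2 * N * ((\<delta> / (16 * real s)) ^ (2 * d) * (1 / 4) ^ s)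
    \<le> (\<Sum>k<2 * N + 1. (norm (\<Sum>m<s. c m * cis (\<theta> m / N) ^ k))\<^sup>2)"
proof -
  define w where "w m = cis (\<theta> m / N)" for m
  define S where "S = {..<s} - {j}"
  \<comment> \<open>Lower bounds for the half-chords, to be reached with shifts of size at most \<open>N / s\<close>.\<close>
  define \<beta> where "\<beta> m = (if m \<in> K then \<delta> / (16 * real s) else 1 / 2)" for m
  have "\<exists>q. real q \<le> N / s \<and> \<beta> m \<le> norm (w j ^ q - w m ^ q) / 2" if "m \<in> S" for m
  proof (cases "m \<in> K")
    case True
    then show ?thesis
      using near_shift[of s N \<delta> "\<theta> j" "\<theta> m"] near[of m] s \<delta> by (simp add: \<beta>_def w_def)
  next
    case False
    then show ?thesis
      using far_shift[of s N "\<theta> j" "\<theta> m"] far[of m] s that by (simp add: \<beta>_def w_def S_def)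
  qed
  then obtain q where q: "\<And>m. m \<in> S \<Longrightarrow> real (q m) \<le> N / s"
    "\<And>m. m \<in> S \<Longrightarrow> \<beta> m \<le> norm (w j ^ q m - w m ^ q m) / 2"
    by metis
  have finK: "finite K" using K finite_subset by blast
  have u: "0 \<le> \<delta> / (16 * real s)" "\<delta> / (16 * real s) \<le> 1"
  proof -
    have "pi * s \<le> 4 * real s" using pi_less_4 by (intro mult_right_mono) auto
    then have "\<delta> \<le> 16 * s" using \<delta> by linarith
    then show "\<delta> / (16 * real s) \<le> 1" using s by simp
  qed (use \<delta> in simp)
  have "(\<Sum>m\<in>S. real (q m)) \<le> of_nat (card S) * (N / s)"
    by (rule sum_bounded_above) (use q in auto)
  also have "card S = s - 1"
    using j by (simp add: S_def)
  also have "real (s - 1) * (N / s) \<le> s * (N / s)"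
    by (intro mult_right_mono) auto
  also have "\<dots> = N" using s by simp
  finally have sumq: "sum q S \<le> N" by (simp flip: of_nat_sum)
  have "(\<delta> / (16 * real s)) ^ (2 * d) * (1 / 4) ^ s
      \<le> ((\<delta> / (16 * real s)) ^ 2) ^ card K * ((1 / 2) ^ 2) ^ card (S - K)"
  proof (rule mult_mono)
    show "(\<delta> / (16 * real s)) ^ (2 * d) \<le> ((\<delta> / (16 * real s))\<^sup>2) ^ card K"
      unfolding power_mult using u K by (intro power_decreasing) (auto simp: power_le_one)
    have "card (S - K) \<le> card {..<s}"
      by (rule card_mono) (auto simp: S_def)
    then show "(1 / 4) ^ s \<le> ((1 / 2 :: real)\<^sup>2) ^ card (S - K)"
      by (simp add: power2_eq_square power_decreasing)
  qed auto
  also have "\<dots> = (\<Prod>m\<in>S. (\<beta> m)\<^sup>2)"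
  proof -
    have "(\<Prod>m\<in>S. (\<beta> m)\<^sup>2) = (\<Prod>m\<in>S - K. (\<beta> m)\<^sup>2) * (\<Prod>m\<in>K. (\<beta> m)\<^sup>2)"
      by (rule prod.subset_diff) (use K in \<open>auto simp: S_def\<close>)
    then show ?thesis by (simp add: \<beta>_def)
  qed
  also have "\<dots> \<le> (\<Prod>m\<in>S. (norm (w j ^ q m - w m ^ q m) / 2)\<^sup>2)"
    using q u by (intro prod_mono conjI power_mono) (auto simp: \<beta>_def)
  finally have "(norm (c j))\<^sup>2 * N * ((\<delta> / (16 * real s)) ^ (2 * d) * (1 / 4) ^ s)
     \<le> (norm (c j))\<^sup>2 * N * (\<Prod>m\<in>S. (norm (w j ^ q m - w m ^ q m) / 2)\<^sup>2)"
    by (rule mult_left_mono) simp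
  also have "\<dots> \<le> (\<Sum>k<N + sum q S. (norm (\<Sum>m\<in>insert j S. c m * w m ^ k))\<^sup>2)"
    by (rule exponential_sum_coefficient_bound) (auto simp: S_def w_def)
  also have "insert j S = {..<s}" using j by (auto simp: S_def)
  also have "(\<Sum>k<N + sum q S. (norm (\<Sum>m<s. c m * w m ^ k))\<^sup>2)
      \<le> (\<Sum>k<2 * N + 1. (norm (\<Sum>m<s. c m * w m ^ k))\<^sup>2)"
    by (rule sum_mono2) (use sumq in auto)
  finally show ?thesis by (simp add: w_def)
qed

text \<open>
  Two nodes in the half-open interval from \<open>- pi / 2\<close> to \<open>pi / 2\<close> differ by less than \<open>pi\<close>, so their
  wrap-around distance is the ordinary distance. The set given by the clustering of \<open>x ! j\<close> then
  translates into a set \<open>K\<close> of indices, and multiplying by \<open>\<Omega>\<close> turns the two distance conditions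
  into conditions on the frequencies \<open>x ! m * \<Omega>\<close>.
\<close>

lemma clustered_configuration_frequencies:
  fixes \<Delta> \<rho> \<tau> \<Omega> :: real
  assumes cfg: "clustered_configuration \<Delta> \<rho> s l \<tau> x" and j: "j < s" and \<Omega>: "\<Omega> > 0"
    and lo: "4 * pi * s \<le> \<rho> * \<Omega>" and hi: "\<tau> * \<Delta> * \<Omega> \<le> pi * s"
  obtains K where "K \<subseteq> {..<s} - {j}" "card K \<le> l - 1"
    "\<And>m. m \<in> K \<Longrightarrow> \<Delta> * \<Omega> \<le> \<bar>x ! j * \<Omega> - x ! m * \<Omega>\<bar> \<and> \<bar>x ! j * \<Omega> - x ! m * \<Omega>\<bar> \<le> pi * s"
    "\<And>m. m \<in> {..<s} - {j} - K \<Longrightarrow>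
      4 * pi * s \<le> \<bar>x ! j * \<Omega> - x ! m * \<Omega>\<bar> \<and> \<bar>x ! j * \<Omega> - x ! m * \<Omega>\<bar> \<le> pi * \<Omega>"
proof -
  define t where "t = x ! j"
  have len: "length x = s" and dist: "distinct x" and sub: "set x \<subseteq> {- (pi / 2) <.. pi / 2}"
    using cfg by (auto simp: clustered_configuration_def)
  have wrap: "wrap_norm (y - t) = \<bar>t - y\<bar>" if "y \<in> set x" for y
  proof -
    have "t \<in> set x" using j len by (simp add: t_def)
    then have "y \<in> {- (pi / 2) <.. pi / 2}" "t \<in> {- (pi / 2) <.. pi / 2}"
      using sub that by blast+
    then have "Arg (exp (\<i> * of_real (y - t))) = y - t"
      by (subst Arg_exp) auto
    then show ?thesis by (simp add: wrap_norm_def abs_minus_commute)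
  qed
  have bd: "\<bar>t - x ! m\<bar> \<le> pi" if "m < s" for m
  proof -
    have "x ! m \<in> set x" "t \<in> set x" using that j len by (auto simp: t_def)
    then have "x ! m \<in> {- (pi / 2) <.. pi / 2}" "t \<in> {- (pi / 2) <.. pi / 2}"
      using sub by blast+
    then show ?thesis by auto
  qed
  have "t \<in> set x" using j len by (simp add: t_def)
  then obtain X where X: "X \<subseteq> set x" "t \<in> X" "card X \<le> l"
    "\<forall>y \<in> X - {t}. \<Delta> \<le> wrap_norm (y - t) \<and> wrap_norm (y - t) \<le> \<tau> * \<Delta>"
    "\<forall>y \<in> set x - X. \<rho> \<le> wrap_norm (y - t)"
    using cfg unfolding clustered_configuration_def by blast
  define K where "K = {m. m < s \<and> m \<noteq> j \<and> x ! m \<in> X}"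
  have scale: "\<bar>x ! j * \<Omega> - x ! m * \<Omega>\<bar> = \<bar>t - x ! m\<bar> * \<Omega>" for m
    using \<Omega> by (simp add: t_def abs_mult flip: left_diff_distrib)
  have ne: "x ! m \<noteq> t" if "m < s" "m \<noteq> j" for m
    using that j len dist by (simp add: t_def nth_eq_iff_index_eq)
  show ?thesis
  proof (rule that[of K])
    have finX: "finite X" using X finite_subset by blast
    have "card K \<le> card (X - {t})"
    proof (rule card_inj_on_le)
      show "inj_on (\<lambda>m. x ! m) K"
        using len dist by (auto simp: inj_on_def K_def nth_eq_iff_index_eq)
      show "(\<lambda>m. x ! m) ` K \<subseteq> X - {t}" using ne by (auto simp: K_def)
    qed (use finX in simp)
    also have "\<dots> \<le> l - 1" using X finX by simp
    finally show "card K \<le> l - 1" .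
  next
    fix m assume m: "m \<in> K"
    then have mm: "x ! m \<in> X - {t}" using ne by (auto simp: K_def)
    then have b: "\<Delta> \<le> \<bar>t - x ! m\<bar>" "\<bar>t - x ! m\<bar> \<le> \<tau> * \<Delta>"
      using X wrap[of "x ! m"] by (metis DiffD1 subsetD)+
    have "\<bar>t - x ! m\<bar> * \<Omega> \<le> \<tau> * \<Delta> * \<Omega>"
      using b \<Omega> by (intro mult_right_mono) auto
    then show "\<Delta> * \<Omega> \<le> \<bar>x ! j * \<Omega> - x ! m * \<Omega>\<bar> \<and> \<bar>x ! j * \<Omega> - x ! m * \<Omega>\<bar> \<le> pi * s"
      using b \<Omega> hi unfolding scale by (intro conjI mult_right_mono) linarith+
  next
    fix m assume m: "m \<in> {..<s} - {j} - K"
    then have "x ! m \<in> set x - X" "x ! m \<in> set x" using len by (auto simp: K_def)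
    then have "\<rho> \<le> \<bar>t - x ! m\<bar>" using X wrap[of "x ! m"] by metis
    then have "\<rho> * \<Omega> \<le> \<bar>t - x ! m\<bar> * \<Omega>" using \<Omega> by (intro mult_right_mono) auto
    then show "4 * pi * s \<le> \<bar>x ! j * \<Omega> - x ! m * \<Omega>\<bar> \<and> \<bar>x ! j * \<Omega> - x ! m * \<Omega>\<bar> \<le> pi * \<Omega>"
      using lo \<Omega> bd[of m] m unfolding scale by (auto intro!: mult_right_mono elim: order_trans)
  qed (auto simp: K_def)
qed

section \<open>Quadratic forms and the smallest eigenvalue\<close>

definition quad_form :: "complex mat \<Rightarrow> (nat \<Rightarrow> complex) \<Rightarrow> complex" where
  "quad_form A v = (\<Sum>i<dim_row A. \<Sum>j<dim_col A. cnj (v i) * A $$ (i, j) * v j)"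

text \<open>
  At an eigenvector \<open>v\<close> for \<open>\<mu>\<close> the form equals \<open>\<mu>\<close> times the squared norm of \<open>v\<close>. As its values
  are real, every complex eigenvalue is real, so the set in the definition of \<open>lambda_min\<close> is
  the whole spectrum; it is finite and nonempty, and its \<open>Min\<close> is meaningful.
\<close>

lemma lambda_min_ge:
  assumes A: "A \<in> carrier_mat n n" and n: "n > 0"
    and form: "\<And>v. \<exists>r. quad_form A v = complex_of_real r \<and> b * (\<Sum>i<n. (norm (v i))\<^sup>2) \<le> r"
  shows "b \<le> lambda_min A"
proof -
  have ev: "\<exists>r. \<mu> = complex_of_real r \<and> b \<le> r" if ev: "eigenvalue A \<mu>" for \<mu>
  proof -
    obtain v where v: "v \<in> carrier_vec n" "v \<noteq> 0\<^sub>v n" "A *\<^sub>v v = \<mu> \<cdot>\<^sub>v v"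
      using ev carrier_matD(1)[OF A] unfolding eigenvalue_def eigenvector_def by blast
    define S where "S = (\<Sum>i<n. (norm (v $ i))\<^sup>2)"
    have "\<exists>i<n. v $ i \<noteq> 0"
    proof (rule ccontr)
      assume "\<not> (\<exists>i<n. v $ i \<noteq> 0)"
      then have "v = 0\<^sub>v n" using v by (intro eq_vecI) auto
      then show False using v by simp
    qed
    then obtain i where "i < n" "v $ i \<noteq> 0" by blast
    then have S: "S > 0" unfolding S_def by (intro sum_pos2[of _ i]) auto
    have row: "(\<Sum>j<n. A $$ (i, j) * v $ j) = \<mu> * v $ i" if "i < n" for i
    proof -
      have "(A *\<^sub>v v) $ i = (\<Sum>j<n. A $$ (i, j) * v $ j)"
        using that A v(1) by (simp add: scalar_prod_def atLeast0LessThan)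
      then show ?thesis using v that by simp
    qed
    have "quad_form A (\<lambda>i. v $ i) = (\<Sum>i<n. cnj (v $ i) * (\<Sum>j<n. A $$ (i, j) * v $ j))"
      using A by (simp add: quad_form_def sum_distrib_left mult.assoc)
    also have "\<dots> = (\<Sum>i<n. \<mu> * complex_of_real ((norm (v $ i))\<^sup>2))"
    proof (rule sum.cong)
      fix i assume "i \<in> {..<n}"
      then show "cnj (v $ i) * (\<Sum>j<n. A $$ (i, j) * v $ j) = \<mu> * complex_of_real ((norm (v $ i))\<^sup>2)"
        using row[of i] unfolding complex_norm_square by (simp only: lessThan_iff mult_ac)
    qed simp
    also have "\<dots> = \<mu> * complex_of_real S"
      by (simp add: S_def sum_distrib_left)
    finally obtain r where r: "\<mu> * complex_of_real S = complex_of_real r" "b * S \<le> r"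
      using form[of "\<lambda>i. v $ i"] unfolding S_def by auto
    have "\<mu> = complex_of_real (r / S)"
      using r(1) S by (simp add: field_simps)
    moreover have "b \<le> r / S" using r(2) S by (simp add: field_simps)
    ultimately show ?thesis by blast
  qed
  let ?E = "{r. eigenvalue A (complex_of_real r)}"
  have "finite (spectrum A)" "spectrum A \<noteq> {}"
    using card_finite_spectrum[OF A] spectrum_non_empty[OF A n] by auto
  moreover have "spectrum A = complex_of_real ` ?E"
    unfolding spectrum_def using ev by auto
  ultimately have E: "finite ?E" "?E \<noteq> {}"
    by (auto dest!: finite_imageD simp: inj_on_def)
  show ?thesis
    unfolding lambda_min_def using ev by (subst Min_ge_iff[OF E]) fastforce
qed

lemma V_gram_carrier: "mat_adjoint (V_mat N x \<Omega>) * V_mat N x \<Omega> \<in> carrier_mat (length x) (length x)"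
  by (auto simp: mat_adjoint_def V_mat_def)

lemma V_gram_index:
  assumes "i < length x" "j < length x"
  shows "(mat_adjoint (V_mat N x \<Omega>) * V_mat N x \<Omega>) $$ (i, j)
    = (\<Sum>r<2 * N + 1. cnj (V_mat N x \<Omega> $$ (r, i)) * V_mat N x \<Omega> $$ (r, j))"
  using assms
  by (simp add: mat_adjoint_def scalar_prod_def atLeast0LessThan V_mat_def mat_of_rows_def)

text \<open>
  Splitting off the phase \<open>cis (- (x ! j * \<Omega>))\<close>, which has modulus \<open>1\<close>, moves the frequencies from
  \<open>-N, \<dots>, N\<close> to \<open>0, \<dots>, 2 * N\<close>, so that column \<open>j\<close> is geometric in the row index.
\<close>

lemma V_mat_index:
  assumes "N > 0" "r < 2 * N + 1" "j < length x"
  shows "V_mat N x \<Omega> $$ (r, j)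
    = of_real (1 / sqrt (2 * N)) * (cis (- (x ! j * \<Omega>)) * cis (x ! j * \<Omega> / N) ^ r)"
proof -
  have "(real r - real N) * (x ! j * \<Omega> / real N) = - (x ! j * \<Omega>) + real r * (x ! j * \<Omega> / real N)"
    using assms by (simp add: field_simps)
  then have "exp (\<i> * complex_of_real ((real r - real N) * (x ! j * \<Omega> / N)))
      = cis (- (x ! j * \<Omega>)) * cis (x ! j * \<Omega> / N) ^ r"
    unfolding Complex.DeMoivre cis_mult by (simp only: cis_conv_exp)
  then show ?thesis
    using assms by (simp add: V_mat_def mult.assoc)
qed

lemma quad_form_V_gram:
  "quad_form (mat_adjoint (V_mat N x \<Omega>) * V_mat N x \<Omega>) v
    = of_real (\<Sum>r<2 * N + 1. (norm (\<Sum>j<length x. V_mat N x \<Omega> $$ (r, j) * v j))\<^sup>2)"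
proof -
  let ?V = "V_mat N x \<Omega>" and ?s = "length x"
  have "quad_form (mat_adjoint ?V * ?V) v
      = (\<Sum>i<?s. \<Sum>j<?s. cnj (v i) * (mat_adjoint ?V * ?V) $$ (i, j) * v j)"
    unfolding quad_form_def carrier_matD[OF V_gram_carrier] by (rule refl)
  also have "\<dots> = (\<Sum>i<?s. \<Sum>j<?s. \<Sum>r<2 * N + 1. cnj (?V $$ (r, i) * v i) * (?V $$ (r, j) * v j))"
    by (intro sum.cong refl)
      (simp add: V_gram_index sum_distrib_left sum_distrib_right mult_ac
        del: sum.lessThan_Suc index_mult_mat(1))
  also have "\<dots> = (\<Sum>i<?s. \<Sum>r<2 * N + 1. \<Sum>j<?s. cnj (?V $$ (r, i) * v i) * (?V $$ (r, j) * v j))"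
    by (intro sum.cong refl sum.swap)
  also have "\<dots> = (\<Sum>r<2 * N + 1. \<Sum>i<?s. \<Sum>j<?s. cnj (?V $$ (r, i) * v i) * (?V $$ (r, j) * v j))"
    by (rule sum.swap)
  also have "\<dots> = (\<Sum>r<2 * N + 1. cnj (\<Sum>j<?s. ?V $$ (r, j) * v j) * (\<Sum>j<?s. ?V $$ (r, j) * v j))"
    by (simp only: sum_product cnj_sum)
  also have "\<dots> = of_real (\<Sum>r<2 * N + 1. (norm (\<Sum>j<?s. ?V $$ (r, j) * v j))\<^sup>2)"
    by (simp only: of_real_sum complex_norm_square mult.commute)
  finally show ?thesis .
qed

section \<open>The limit of the Gram matrices\<close>

text \<open>
  Written without division, so that it also holds where \<open>sin (a / 2)\<close> vanishes; the
  factor makes the sum telescope.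
\<close>

lemma dirichlet_kernel:
  "(\<Sum>r<2 * N + 1. cis ((real r - real N) * a)) * (2 * \<i> * of_real (sin (a / 2)))
    = 2 * \<i> * of_real (sin ((2 * real N + 1) * a / 2))"
proof -
  have two: "2 * \<i> * of_real (sin b) = cis b - cis (- b)" for b
    by (simp add: complex_eq_iff)
  have "(\<Sum>r<n. cis ((real r - real N) * a)) * (cis (a / 2) - cis (- (a / 2)))
    = cis ((real n - real N - 1 / 2) * a) - cis ((- real N - 1 / 2) * a)" for n
    by (induction n) (simp_all add: algebra_simps cis_mult add_divide_distrib diff_divide_distrib)
  from this[of "2 * N + 1"] show ?thesis
    unfolding two by (simp add: algebra_simps add_divide_distrib diff_divide_distrib)
qed

lemma dirichlet_kernel_tendsto_sinc:
  "(\<lambda>N. (\<Sum>r<2 * N + 1. cis ((real r - real N) * (a / N))) / of_nat (2 * N))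
    \<longlonglongrightarrow> of_real (sinc a)"
proof (cases "a = 0")
  case True
  have "(\<lambda>N. (2 * real N + 1) / (2 * real N)) \<longlonglongrightarrow> 1" by real_asymp
  then have "(\<lambda>N. complex_of_real ((2 * real N + 1) / (2 * real N))) \<longlonglongrightarrow> of_real 1"
    by (rule tendsto_of_real)
  then show ?thesis using True by (simp add: algebra_simps)
next
  case False
  have "(\<lambda>N. 2 * real N * sin (a / real N / 2)) \<longlonglongrightarrow> a"
    using False by real_asymp
  moreover have "(\<lambda>N. sin ((2 * real N + 1) * (a / real N) / 2)) \<longlonglongrightarrow> sin a"
  proof (rule tendsto_sin)
    show "(\<lambda>N. (2 * real N + 1) * (a / real N) / 2) \<longlonglongrightarrow> a"
      using False by real_asymp
  qed
  ultimately have "(\<lambda>N. sin ((2 * real N + 1) * (a / real N) / 2) / (2 * real N * sin (a / real N / 2)))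
      \<longlonglongrightarrow> sin a / a"
    using False by (intro tendsto_divide) auto
  then have "(\<lambda>N. complex_of_real (sin ((2 * real N + 1) * (a / real N) / 2) / (2 * real N * sin (a / real N / 2))))
      \<longlonglongrightarrow> of_real (sinc a)"
    using False by (auto dest!: tendsto_of_real simp del: of_real_divide of_real_mult)
  moreover have "eventually (\<lambda>N. 2 * real N * sin (a / real N / 2) \<noteq> 0) sequentially"
    using \<open>(\<lambda>N. 2 * real N * sin (a / real N / 2)) \<longlonglongrightarrow> a\<close> False tendsto_imp_eventually_ne by blast
  then have "eventually (\<lambda>N. complex_of_real (sin ((2 * real N + 1) * (a / real N) / 2) / (2 * real N * sin (a / real N / 2)))
      = (\<Sum>r<2 * N + 1. cis ((real r - real N) * (a / N))) / of_nat (2 * N)) sequentially"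
  proof eventually_elim
    case (elim N)
    then have "(\<Sum>r<2 * N + 1. cis ((real r - real N) * (a / N)))
      = of_real (sin ((2 * real N + 1) * (a / real N) / 2) / sin (a / real N / 2))"
      using dirichlet_kernel[of N "a / N"] by (simp add: field_simps del: sum.lessThan_Suc)
    then show ?case using elim by simp
  qed
  ultimately show ?thesis
    by (rule Lim_transform_eventually)
qed

lemma V_gram_tendsto_G:
  assumes "i < length x" "j < length x"
  shows "(\<lambda>N. (mat_adjoint (V_mat N x \<Omega>) * V_mat N x \<Omega>) $$ (i, j)) \<longlonglongrightarrow> G_mat x \<Omega> $$ (i, j)"
proof -
  define a where "a = \<Omega> * (x ! j - x ! i)"
  have "(mat_adjoint (V_mat N x \<Omega>) * V_mat N x \<Omega>) $$ (i, j)
    = (\<Sum>r<2 * N + 1. cis ((real r - real N) * (a / N))) / of_nat (2 * N)" if "N > 0" for N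
  proof -
    have "cnj (V_mat N x \<Omega> $$ (r, i)) * V_mat N x \<Omega> $$ (r, j) = cis ((real r - real N) * (a / N)) / of_nat (2 * N)"
      if r: "r < 2 * N + 1" for r
    proof -
      have "- (- (x ! i * \<Omega>) + real r * (x ! i * \<Omega> / real N)) + (- (x ! j * \<Omega>) + real r * (x ! j * \<Omega> / real N))
        = (real r - real N) * (a / real N)"
        using \<open>N > 0\<close> by (simp add: a_def field_simps)
      then have "cnj (cis (- (x ! i * \<Omega>)) * cis (x ! i * \<Omega> / real N) ^ r)
          * (cis (- (x ! j * \<Omega>)) * cis (x ! j * \<Omega> / real N) ^ r) = cis ((real r - real N) * (a / real N))"
        unfolding Complex.DeMoivre cis_mult cis_cnj by (rule arg_cong)
      moreover have "complex_of_real (1 / sqrt (2 * N)) * complex_of_real (1 / sqrt (2 * N)) = 1 / of_nat (2 * N)"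
        by (simp flip: of_real_mult) simp
      moreover have "cnj (of_real p * y) * (of_real p * z) = cnj y * z * (of_real p * of_real p)" for p y z
        by simp
      ultimately show ?thesis
        using assms r \<open>N > 0\<close> by (simp only: V_mat_index) simp
    qed
    then show ?thesis
      using assms by (simp add: V_gram_index sum_divide_distrib del: sum.lessThan_Suc index_mult_mat(1))
  qed
  then have "eventually (\<lambda>N. (\<Sum>r<2 * N + 1. cis ((real r - real N) * (a / N))) / of_nat (2 * N)
      = (mat_adjoint (V_mat N x \<Omega>) * V_mat N x \<Omega>) $$ (i, j)) sequentially"
    by (intro eventually_sequentiallyI[of 1]) (simp del: sum.lessThan_Suc index_mult_mat(1))
  moreover have "G_mat x \<Omega> $$ (i, j) = of_real (sinc a)"
  proof -
    have "\<Omega> * (x ! i - x ! j) = - a" by (simp add: a_def right_diff_distrib)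
    have "sinc (- a) = sinc a" by simp
    have "G_mat x \<Omega> $$ (i, j) = of_real (sinc (\<Omega> * (x ! i - x ! j)))"
      using assms by (simp only: G_mat_def index_mat prod.case)
    also have "\<dots> = of_real (sinc (- a))"
      by (simp only: \<open>\<Omega> * (x ! i - x ! j) = - a\<close>)
    also have "\<dots> = of_real (sinc a)"
      by (simp only: \<open>sinc (- a) = sinc a\<close>)
    finally show ?thesis .
  qed
  ultimately show ?thesis
    by (simp only: Lim_transform_eventually[OF dirichlet_kernel_tendsto_sinc[of a]])
qed

lemma quad_form_V_gram_tendsto_G:
  "(\<lambda>N. quad_form (mat_adjoint (V_mat N x \<Omega>) * V_mat N x \<Omega>) v) \<longlonglongrightarrow> quad_form (G_mat x \<Omega>) v"
proof -
  have d: "dim_row (G_mat x \<Omega>) = length x" "dim_col (G_mat x \<Omega>) = length x"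
    by (simp_all add: G_mat_def)
  show ?thesis
    unfolding quad_form_def d carrier_matD[OF V_gram_carrier]
    by (intro tendsto_sum tendsto_mult tendsto_const V_gram_tendsto_G) auto
qed

section \<open>The conditioning bounds\<close>

text \<open>
  Each single squared modulus \<open>\<bar>v j\<bar>\<^sup>2\<close> is bounded by the energy; averaging over the \<open>s\<close> indices
  bounds the squared norm and costs the factor \<open>1 / s\<close>.
\<close>

lemma V_form_lower_bound:
  fixes \<Delta> \<rho> \<tau> \<Omega> :: real
  assumes cfg: "clustered_configuration \<Delta> \<rho> s l \<tau> x" and "s > 0" "\<Delta> > 0"
    and \<Omega>: "\<Omega> > 0" and lo: "4 * pi * s \<le> \<rho> * \<Omega>" and hi: "\<tau> * \<Delta> * \<Omega> \<le> pi * s"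
    and \<tau>: "1 \<le> \<tau>" and N: "2 * s \<le> N" "2 * \<Omega> \<le> N"
  shows "(\<Delta> * \<Omega> / (16 * real s)) ^ (2 * (l - 1)) * (1 / 4) ^ s / (2 * real s) * (\<Sum>j<s. (norm (v j))\<^sup>2)
    \<le> (\<Sum>r<2 * N + 1. (norm (\<Sum>j<s. V_mat N x \<Omega> $$ (r, j) * v j))\<^sup>2)"
proof -
  define B where "B = (\<Delta> * \<Omega> / (16 * real s)) ^ (2 * (l - 1)) * (1 / 4) ^ s"
  define F where "F = (\<Sum>r<2 * N + 1. (norm (\<Sum>j<s. V_mat N x \<Omega> $$ (r, j) * v j))\<^sup>2)"
  define c where "c j = v j * cis (- (x ! j * \<Omega>))" for j
  have N0: "N > 0" using assms by simp
  have len: "length x = s" using cfg by (simp add: clustered_configuration_def)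
  have F: "(\<Sum>k<2 * N + 1. (norm (\<Sum>m<s. c m * cis (x ! m * \<Omega> / N) ^ k))\<^sup>2) = 2 * N * F"
  proof -
    have "(norm (\<Sum>j<s. V_mat N x \<Omega> $$ (r, j) * v j))\<^sup>2
      = (norm (\<Sum>m<s. c m * cis (x ! m * \<Omega> / N) ^ r))\<^sup>2 / (2 * N)" if "r < 2 * N + 1" for r
    proof -
      have "(\<Sum>j<s. V_mat N x \<Omega> $$ (r, j) * v j)
        = of_real (1 / sqrt (2 * N)) * (\<Sum>m<s. c m * cis (x ! m * \<Omega> / N) ^ r)"
        unfolding sum_distrib_left
        by (rule sum.cong) (use that N0 len in \<open>simp_all add: V_mat_index c_def mult_ac\<close>)
      then show ?thesis
        by (simp add: norm_mult norm_divide power_mult_distrib power_divide)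
    qed
    then show ?thesis
      using N0 by (simp add: F_def sum_distrib_left del: sum.lessThan_Suc)
  qed
  have \<delta>: "\<Delta> * \<Omega> \<le> pi * s"
  proof -
    have "1 * (\<Delta> * \<Omega>) \<le> \<tau> * (\<Delta> * \<Omega>)" using assms by (intro mult_right_mono) auto
    then show ?thesis using hi by (simp add: mult.assoc)
  qed
  have one: "(norm (v j))\<^sup>2 * B \<le> 2 * F" if j: "j < s" for j
  proof -
    obtain K where K: "K \<subseteq> {..<s} - {j}" "card K \<le> l - 1"
      "\<And>m. m \<in> K \<Longrightarrow> \<Delta> * \<Omega> \<le> \<bar>x ! j * \<Omega> - x ! m * \<Omega>\<bar> \<and> \<bar>x ! j * \<Omega> - x ! m * \<Omega>\<bar> \<le> pi * s"
      "\<And>m. m \<in> {..<s} - {j} - K \<Longrightarrow>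
        4 * pi * s \<le> \<bar>x ! j * \<Omega> - x ! m * \<Omega>\<bar> \<and> \<bar>x ! j * \<Omega> - x ! m * \<Omega>\<bar> \<le> pi * \<Omega>"
      using clustered_configuration_frequencies[OF cfg j \<Omega> lo hi] by blast
    have "pi * (2 * \<Omega>) \<le> pi * N"
      using N by (intro mult_left_mono) auto
    then have far: "4 * pi * s \<le> \<bar>x ! j * \<Omega> - x ! m * \<Omega>\<bar> \<and> \<bar>x ! j * \<Omega> - x ! m * \<Omega>\<bar> \<le> pi * N / 2"
      if "m \<in> {..<s} - {j} - K" for m
      using K(4)[OF that] by linarith
    have "(norm (c j))\<^sup>2 * N * B \<le> 2 * N * F"
      unfolding B_def F[symmetric]
      by (rule clustered_sum_coefficient_bound[where \<theta> = "\<lambda>m. x ! m * \<Omega>" and K = K and \<delta> = "\<Delta> * \<Omega>"])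
        (use \<open>s > 0\<close> N j \<delta> K(1,2,3) far \<open>\<Delta> > 0\<close> \<Omega> in \<open>simp_all only: mult_pos_pos\<close>)
    moreover have "norm (c j) = norm (v j)" by (simp add: c_def norm_mult)
    ultimately have "N * ((norm (v j))\<^sup>2 * B) \<le> N * (2 * F)" by (simp add: mult_ac)
    then show ?thesis using N0 by simp
  qed
  have "(\<Sum>j<s. (norm (v j))\<^sup>2 * B) \<le> of_nat (card {..<s}) * (2 * F)"
    by (rule sum_bounded_above) (use one in auto)
  then have "B * (\<Sum>j<s. (norm (v j))\<^sup>2) \<le> 2 * real s * F"
    by (simp add: sum_distrib_left mult_ac)
  then have "B / (2 * real s) * (\<Sum>j<s. (norm (v j))\<^sup>2) \<le> F"
    using \<open>s > 0\<close> by (simp add: field_simps)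
  then show ?thesis by (simp add: B_def F_def)
qed

theorem theorem3p2:
  fixes s :: nat
  assumes "s \<ge> 2"
  shows "\<exists>C::real. C > 0 \<and>
    (\<forall>(\<Delta>::real) (\<rho>::real) (l::nat) (\<tau>::real) (x::real list) (\<Omega>::real).
       \<Delta> > 0 \<longrightarrow> \<rho> \<ge> 0 \<longrightarrow> 2 \<le> l \<longrightarrow> l \<le> s \<longrightarrow>
       real l - 1 \<le> \<tau> \<longrightarrow> \<tau> < pi / \<Delta> \<longrightarrow> 4 * \<tau> * \<Delta> \<le> \<rho> \<longrightarrow>
       clustered_configuration \<Delta> \<rho> s l \<tau> x \<longrightarrow>
       4 * pi * real s / \<rho> \<le> \<Omega> \<longrightarrow> \<Omega> \<le> pi * real s / (\<tau> * \<Delta>) \<longrightarrow>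
       (\<forall>N::nat. int N > 2 * int s ^ 3 * \<lceil>\<Omega> / (4 * real s)\<rceil> \<longrightarrow>
          sigma_min (V_mat N x \<Omega>) \<ge> C * (\<Delta> * \<Omega>) ^ (l - 1)) \<and>
       lambda_min (G_mat x \<Omega>) \<ge> C\<^sup>2 * (\<Delta> * \<Omega>) ^ (2 * (l - 1)))"
proof -
  \<comment> \<open>The power \<open>(16 * s) ^ (2 * (l - 1))\<close> from the form bound is replaced by one that does not
    depend on \<open>l\<close>.\<close>
  define C where "C = sqrt ((1 / 4) ^ s / (2 * real s) / (16 * real s) ^ (2 * s))"
  have C: "C > 0" using assms by (simp add: C_def)
  have C2: "C\<^sup>2 = (1 / 4) ^ s / (2 * real s) / (16 * real s) ^ (2 * s)" by (simp add: C_def)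
  show ?thesis
  proof (intro exI[of _ C] conjI[OF C] allI impI)
    fix \<Delta> \<rho> \<tau> \<Omega> :: real and l :: nat and x :: "real list"
    assume \<Delta>: "\<Delta> > 0" and \<rho>: "\<rho> \<ge> 0" and l: "2 \<le> l" "l \<le> s" and \<tau>: "real l - 1 \<le> \<tau>" "\<tau> < pi / \<Delta>"
      and \<rho>\<tau>: "4 * \<tau> * \<Delta> \<le> \<rho>" and cfg: "clustered_configuration \<Delta> \<rho> s l \<tau> x"
      and \<Omega>1: "4 * pi * real s / \<rho> \<le> \<Omega>" and \<Omega>2: "\<Omega> \<le> pi * real s / (\<tau> * \<Delta>)"
    define b where "b = (\<Delta> * \<Omega> / (16 * real s)) ^ (2 * (l - 1)) * (1 / 4) ^ s / (2 * real s)"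
    have len: "length x = s" using cfg by (simp add: clustered_configuration_def)
    have s: "s > 0" using assms by simp
    have \<tau>1: "1 \<le> \<tau>" using \<tau> l by simp
    then have "0 < 4 * \<tau> * \<Delta>" using \<Delta> by simp
    then have \<rho>0: "\<rho> > 0" using \<rho>\<tau> by linarith
    have "0 < 4 * pi * real s / \<rho>" using \<rho>0 s by simp
    then have \<Omega>: "\<Omega> > 0" using \<Omega>1 by linarith
    have lo: "4 * pi * s \<le> \<rho> * \<Omega>" using \<Omega>1 \<rho>0 by (simp add: field_simps)
    have hi: "\<tau> * \<Delta> * \<Omega> \<le> pi * s" using \<Omega>2 \<tau>1 \<Delta> by (simp add: field_simps)
    have Cb: "C\<^sup>2 * (\<Delta> * \<Omega>) ^ (2 * (l - 1)) \<le> b"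
    proof -
      have "C\<^sup>2 * (\<Delta> * \<Omega>) ^ (2 * (l - 1)) \<le> (1 / 4) ^ s / (2 * real s) / (16 * real s) ^ (2 * (l - 1)) * (\<Delta> * \<Omega>) ^ (2 * (l - 1))"
        unfolding C2 using s l \<Delta> \<Omega>
        by (intro mult_right_mono divide_left_mono power_increasing) auto
      also have "\<dots> = b" by (simp add: b_def power_divide)
      finally show ?thesis .
    qed
    have V: "b * (\<Sum>j<s. (norm (v j))\<^sup>2) \<le> (\<Sum>r<2 * N + 1. (norm (\<Sum>j<s. V_mat N x \<Omega> $$ (r, j) * v j))\<^sup>2)"
      if "2 * s \<le> N" "2 * \<Omega> \<le> N" for N v
      unfolding b_def by (rule V_form_lower_bound[OF cfg s \<Delta> \<Omega> lo hi \<tau>1 that])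
    show "(\<forall>N::nat. int N > 2 * int s ^ 3 * \<lceil>\<Omega> / (4 * real s)\<rceil> \<longrightarrow>
          sigma_min (V_mat N x \<Omega>) \<ge> C * (\<Delta> * \<Omega>) ^ (l - 1)) \<and>
       lambda_min (G_mat x \<Omega>) \<ge> C\<^sup>2 * (\<Delta> * \<Omega>) ^ (2 * (l - 1))"
    proof (intro conjI allI impI)
      fix N :: nat
      assume N: "int N > 2 * int s ^ 3 * \<lceil>\<Omega> / (4 * real s)\<rceil>"
      define M where "M = \<lceil>\<Omega> / (4 * real s)\<rceil>"
      have M: "1 \<le> M" "\<Omega> / (4 * real s) \<le> M"
        using \<Omega> s by (auto simp: M_def one_le_ceiling)
      \<comment> \<open>The condition on \<open>N\<close> serves twice: the ceiling is at least \<open>1\<close>, so \<open>N \<ge> 2 * s\<close> and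
        rounding the shifts to integers is harmless; and it is at least \<open>\<Omega> / (4 * s)\<close>, so \<open>N \<ge> 2 * \<Omega>\<close> and far nodes are not aliased.\<close>
      have s2: "4 * int s \<le> int s ^ 3"
      proof -
        have "2 * 2 * int s \<le> int s * int s * int s"
          using assms by (intro mult_mono) auto
        then show ?thesis by (simp add: power3_eq_cube)
      qed
      have "8 * int s * M \<le> 2 * int s ^ 3 * M"
        using s2 M by (intro mult_right_mono) auto
      then have NM: "8 * int s * M \<le> int N"
        using N unfolding M_def by linarith
      have "8 * int s * 1 \<le> 8 * int s * M"
        using M by (intro mult_left_mono) auto
      then have N1: "2 * s \<le> N" using NM by linarith
      have "2 * \<Omega> \<le> 8 * real s * M"
        using M s by (simp add: field_simps)
      also have "\<dots> \<le> N"
        using of_int_le_iff[of "8 * int s * M" "int N", where 'a = real] NM by simp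
      finally have N2: "2 * \<Omega> \<le> N" .
      have "b \<le> lambda_min (mat_adjoint (V_mat N x \<Omega>) * V_mat N x \<Omega>)"
      proof (rule lambda_min_ge)
        show "mat_adjoint (V_mat N x \<Omega>) * V_mat N x \<Omega> \<in> carrier_mat s s"
          using V_gram_carrier[of N x \<Omega>] len by simp
        show "\<exists>r. quad_form (mat_adjoint (V_mat N x \<Omega>) * V_mat N x \<Omega>) v = complex_of_real r \<and>
            b * (\<Sum>i<s. (norm (v i))\<^sup>2) \<le> r" for v
          using V[OF N1 N2, of v] unfolding quad_form_V_gram len by blast
      qed (fact s)
      with Cb have "C\<^sup>2 * (\<Delta> * \<Omega>) ^ (2 * (l - 1)) \<le> lambda_min (mat_adjoint (V_mat N x \<Omega>) * V_mat N x \<Omega>)"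
        by linarith
      then have "(C * (\<Delta> * \<Omega>) ^ (l - 1))\<^sup>2 \<le> lambda_min (mat_adjoint (V_mat N x \<Omega>) * V_mat N x \<Omega>)"
        by (simp add: power_mult_distrib mult.commute flip: power_mult)
      then show "sigma_min (V_mat N x \<Omega>) \<ge> C * (\<Delta> * \<Omega>) ^ (l - 1)"
        unfolding sigma_min_def by (rule real_le_rsqrt)
    next
      have "b \<le> lambda_min (G_mat x \<Omega>)"
      proof (rule lambda_min_ge)
        show "G_mat x \<Omega> \<in> carrier_mat s s" by (simp add: G_mat_def len)
        fix v
        let ?Q = "\<lambda>N. quad_form (mat_adjoint (V_mat N x \<Omega>) * V_mat N x \<Omega>) v"
        have lim: "?Q \<longlonglongrightarrow> quad_form (G_mat x \<Omega>) v"
          by (rule quad_form_V_gram_tendsto_G)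
        have "Im (?Q N) = 0" for N
          by (simp only: quad_form_V_gram Im_complex_of_real)
        then have "Im (quad_form (G_mat x \<Omega>) v) = 0"
          using tendsto_Im[OF lim] by (simp add: LIMSEQ_const_iff)
        then have "quad_form (G_mat x \<Omega>) v = of_real (Re (quad_form (G_mat x \<Omega>) v))"
          by (simp add: complex_eq_iff)
        moreover have "b * (\<Sum>i<s. (norm (v i))\<^sup>2) \<le> Re (quad_form (G_mat x \<Omega>) v)"
        proof (rule tendsto_lowerbound[OF tendsto_Re[OF lim]])
          have "eventually (\<lambda>N. 2 * s \<le> N \<and> 2 * \<Omega> \<le> real N) sequentially"
            by (intro eventually_conj eventually_ge_at_top) real_asymp
          then show "eventually (\<lambda>N. b * (\<Sum>i<s. (norm (v i))\<^sup>2) \<le> Re (?Q N)) sequentially"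
          proof eventually_elim
            case (elim N)
            then show ?case
              using V[of N v] by (simp only: quad_form_V_gram Re_complex_of_real len)
          qed
        qed simp
        ultimately show "\<exists>r. quad_form (G_mat x \<Omega>) v = complex_of_real r \<and> b * (\<Sum>i<s. (norm (v i))\<^sup>2) \<le> r"
          by blast
      qed (fact s)
      with Cb show "lambda_min (G_mat x \<Omega>) \<ge> C\<^sup>2 * (\<Delta> * \<Omega>) ^ (2 * (l - 1))" by linarith
    qed
  qed
qed

end
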